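(* Let $G$ be a graph of order $n$ with minimum degree $\delta(G)=0$. Then $\mathcal{C}(G)=n$ if and only if $G \cong K_1 \cup K_{n-1}$ (the disjoint union of an isolated vertex and a complete graph on $n-1$ vertices).
   Context: All graphs are finite, simple (no loops or multiple edges). For a graph $G$ with vertex set $V$, a set $S\subseteq V$ is a dominating set if every vertex of $V\setminus S$ is adjacent to a vertex of $S$. Two disjoint sets $V_1,V_2\subseteq V$ form a coalition in $G$ if neither $V_1$ nor $V_2$ is a dominating set of $G$ but $V_1\cup V_2$ is. A coalition partition of $G$ is a partition $\Psi=\{V_1,\ldots,V_k\}$ of $V$ such that every $V_i\in\Psi$ is either a dominating set of $G$ with $|V_i|=1$, or is not a dominating set and forms a coalition with some $V_j\in\Psi$. The coalition number $\mathcal{C}(G)$ is the maximum cardinality of a coalition partition of $G$. The order of $G$ is $n=|V|$. *)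

theory Defs
  imports "Graph_Theory.Graph_Theory" "HOL-Library.Disjoint_Sets"
begin

text \<open>
  Finite simple graphs are modelled by the locale \<^locale>\<open>graph\<close>: finite symmetric
  digraphs without loops and parallel arcs, each undirected edge being a pair of opposite
  arcs. The null graph is not excluded by that locale.
\<close>

text \<open>
  In such a graph the arcs leaving a vertex correspond to its neighbours, so its degree is
  its out-degree. The minimum is meaningful only when there is at least one vertex.
\<close>

definition min_degree :: "('a,'b) pre_digraph \<Rightarrow> nat" where
  "min_degree G = Min (out_degree G ` verts G)"

definition dominating_set :: "('a,'b) pre_digraph \<Rightarrow> 'a set \<Rightarrow> bool" where
  "dominating_set G S \<longleftrightarrow> S \<subseteq> verts G \<and> (\<forall>v \<in> verts G - S. \<exists>u \<in> S. v \<rightarrow>\<^bsub>G\<^esub> u)"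

definition coalition :: "('a,'b) pre_digraph \<Rightarrow> 'a set \<Rightarrow> 'a set \<Rightarrow> bool" where
  "coalition G A B \<longleftrightarrow> A \<subseteq> verts G \<and> B \<subseteq> verts G \<and> A \<inter> B = {} \<and>
     \<not> dominating_set G A \<and> \<not> dominating_set G B \<and> dominating_set G (A \<union> B)"

definition coalition_partition :: "('a,'b) pre_digraph \<Rightarrow> 'a set set \<Rightarrow> bool" where
  "coalition_partition G P \<longleftrightarrow> partition_on (verts G) P \<and>
     (\<forall>A \<in> P. (dominating_set G A \<and> card A = 1) \<or>
              (\<not> dominating_set G A \<and> (\<exists>B \<in> P. coalition G A B)))"

definition coalition_number :: "('a,'b) pre_digraph \<Rightarrow> nat" where
  "coalition_number G = Max {card P | P. coalition_partition G P}"

definition disjoint_union ::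
    "('a,'b) pre_digraph \<Rightarrow> ('c,'d) pre_digraph \<Rightarrow> ('a + 'c, 'b + 'd) pre_digraph" where
  "disjoint_union G H = \<lparr> verts = verts G <+> verts H, arcs = arcs G <+> arcs H,
     tail = map_sum (tail G) (tail H), head = map_sum (head G) (head H) \<rparr>"

definition complete_graph :: "nat \<Rightarrow> (nat, nat \<times> nat) pre_digraph" where
  "complete_graph n =
     with_proj \<lparr> pverts = {..<n}, parcs = {(u, v). u < n \<and> v < n \<and> u \<noteq> v} \<rparr>"

lemma complete_digraph_complete_graph: "K\<^bsub>n\<^esub> (complete_graph n)"
  by (auto simp: complete_graph_def complete_digraph_pair_def)

end

theory Submission
  imports Defs
begin

text \<open>
  A partition of size \<open>n\<close> consists of singletons. Every dominating set contains the isolated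
  vertex \<open>v\<close>, so if \<open>n \<ge> 2\<close>, each \<open>{w}\<close> with \<open>w \<noteq> v\<close> can only form a coalition
  with \<open>{v}\<close>, which means that \<open>w\<close> is adjacent to every vertex other than \<open>v\<close>. The
  coalition number is a genuine maximum because \<open>{{v}, V - {v}}\<close> is a coalition partition.
\<close>

section \<open>Partitions of maximal size and the coalition number\<close>

lemma card_partition_on_le:
  assumes "partition_on A P" "finite A"
  shows "card P \<le> card A"
proof -
  have "(\<Sum>p\<in>P. 1) \<le> (\<Sum>p\<in>P. card p)"
    using assms by (intro sum_mono)
      (metis One_nat_def Suc_leI card_gt_0_iff finite_elements finite_subset partition_onD1
        partition_onD3 Union_upper)
  then show ?thesis
    using product_partition[OF assms(1)] assms
    by (metis card_eq_sum finite_subset partition_onD1 Union_upper)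
qed

text \<open>Choosing a representative in each block is injective because blocks are disjoint. Equal
  cardinalities make it surjective onto \<open>A\<close>, so every element of a block represents
  that block and must be its only element.\<close>

lemma partition_on_card_eq_singletons:
  assumes P: "partition_on A P" and A: "finite A" and card: "card P = card A"
  shows "P = (\<lambda>x. {x}) ` A"
proof -
  define r where "r p = (SOME x. x \<in> p)" for p :: "'a set"
  have r: "r p \<in> p" if "p \<in> P" for p
    using that partition_onD3[OF P] unfolding r_def by (metis some_in_eq)
  have same: "p = q" if "p \<in> P" "q \<in> P" "x \<in> p" "x \<in> q" for p q x
    using partition_onD2[OF P] that by (auto simp: disjoint_def)
  have "inj_on r P"
    using r same by (metis inj_onI)
  moreover have "r ` P \<subseteq> A"
    using r partition_onD1[OF P] by auto
  ultimately have rA: "r ` P = A"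
    using A card by (metis card_image card_subset_eq)
  have single: "p = {r p}" if p: "p \<in> P" for p
  proof -
    have "y = r p" if y: "y \<in> p" for y
    proof -
      have "y \<in> r ` P"
        using p y rA partition_onD1[OF P] by auto
      then show ?thesis
        using r same p y by blast
    qed
    then show ?thesis
      using r[OF p] by blast
  qed
  have "P = (\<lambda>x. {x}) ` r ` P"
    unfolding image_image using single by (metis (no_types, lifting) image_cong image_ident)
  with rA show ?thesis
    by simp
qed

text \<open>The witness \<open>Q\<close> makes the set under \<open>Max\<close> nonempty, and no
  member exceeds the order. Hence the maximum is the order exactly when the order is attained, and
  only the partition into singletons can attain it.\<close>

lemma coalition_number_eq_card_iff:
  assumes fin: "finite (verts G)" and ex: "coalition_partition G Q"
  shows "coalition_number G = card (verts G)
    \<longleftrightarrow> coalition_partition G ((\<lambda>x. {x}) ` verts G)"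
proof -
  let ?C = "{card P | P. coalition_partition G P}"
  have le: "c \<le> card (verts G)" if "c \<in> ?C" for c
    using that card_partition_on_le fin by (auto simp: coalition_partition_def)
  then have finC: "finite ?C"
    by (meson finite_nat_set_iff_bounded_le)
  have neC: "?C \<noteq> {}"
    using ex by auto
  have "Max ?C = card (verts G) \<longleftrightarrow> card (verts G) \<in> ?C"
    by (subst eq_commute, subst eq_Max_iff[OF finC neC]) (use le in blast)
  also have "\<dots> \<longleftrightarrow> coalition_partition G ((\<lambda>x. {x}) ` verts G)"
  proof
    assume "card (verts G) \<in> ?C"
    then obtain P where "coalition_partition G P" "card P = card (verts G)"
      by auto
    then show "coalition_partition G ((\<lambda>x. {x}) ` verts G)"
      using partition_on_card_eq_singletons[OF _ fin] by (metis coalition_partition_def)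
  next
    assume *: "coalition_partition G ((\<lambda>x. {x}) ` verts G)"
    have "card ((\<lambda>x. {x}) ` verts G) = card (verts G)"
      by (simp add: card_image)
    with * show "card (verts G) \<in> ?C"
      by (metis (mono_tags, lifting) mem_Collect_eq)
  qed
  finally show ?thesis
    by (simp add: coalition_number_def)
qed

section \<open>Domination and coalitions in the presence of an isolated vertex\<close>

lemma ex_isolated_vertex:
  assumes "fin_digraph G" "verts G \<noteq> {}" "min_degree G = 0"
  obtains v where "v \<in> verts G" "\<And>u. \<not> v \<rightarrow>\<^bsub>G\<^esub> u"
proof -
  interpret fin_digraph G by fact
  have "min_degree G \<in> out_degree G ` verts G"
    unfolding min_degree_def using assms(2) by (intro Min_in) auto
  then obtain v where v: "v \<in> verts G" "out_degree G v = 0"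
    using assms(3) by auto
  then have "out_arcs G v = {}"
    by (simp add: out_degree_def finite_out_arcs)
  then have "\<not> v \<rightarrow>\<^bsub>G\<^esub> u" for u
    by (auto simp: out_arcs_def)
  with v that show ?thesis by blast
qed

lemma isolated_in_dominating_set:
  assumes "dominating_set G S" "v \<in> verts G" "\<And>u. \<not> v \<rightarrow>\<^bsub>G\<^esub> u"
  shows "v \<in> S"
  using assms by (auto simp: dominating_set_def)

lemma dominating_set_verts: "dominating_set G (verts G)"
  by (auto simp: dominating_set_def)

lemma ex_coalition_partition_isolated:
  assumes v: "v \<in> verts G" and iso: "\<And>u. \<not> v \<rightarrow>\<^bsub>G\<^esub> u" "\<And>u. \<not> u \<rightarrow>\<^bsub>G\<^esub> v"
  shows "\<exists>P. coalition_partition G P"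
\<comment> \<open>If \<open>v\<close> is the only vertex, its complement would be an empty block,
  but \<open>{v}\<close> is then a dominating singleton.\<close>
proof (cases "verts G = {v}")
  case True
  have "partition_on (verts G) {{v}}"
    unfolding True by (simp add: partition_on_space)
  then have "coalition_partition G {{v}}"
    using dominating_set_verts[of G] True by (simp add: coalition_partition_def)
  then show ?thesis ..
next
  case False
  let ?A = "{v}" and ?B = "verts G - {v}"
  have "\<not> dominating_set G ?A"
    using False v iso(2) by (auto simp: dominating_set_def)
  moreover have "\<not> dominating_set G ?B"
    using isolated_in_dominating_set[OF _ v iso(1)] by blast
  moreover have un: "?A \<union> ?B = verts G" "?B \<union> ?A = verts G"
    using v by auto
  ultimately have "coalition G ?A ?B" "coalition G ?B ?A"
    using v unfolding coalition_def un by (auto simp: dominating_set_verts)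
  moreover have "partition_on (verts G) {?A, ?B}"
    using v False by (auto simp: partition_on_def disjoint_def)
  ultimately have "coalition_partition G {?A, ?B}"
    unfolding coalition_partition_def by (auto simp: coalition_def)
  then show ?thesis ..
qed

text \<open>The condition on coalitions becomes an explicit edge set, to which the isomorphism
  condition is reduced as well. The inclusion \<open>sub\<close> holds in any case; the content is
  that all pairs avoiding \<open>v\<close> are adjacent.\<close>

lemma singleton_coalition_partition_iff:
  assumes G: "graph G" and v: "v \<in> verts G" and iso: "\<And>u. \<not> v \<rightarrow>\<^bsub>G\<^esub> u"
  shows "coalition_partition G ((\<lambda>x. {x}) ` verts G)
    \<longleftrightarrow> arcs_ends G = {(a, b). a \<in> verts G - {v} \<and> b \<in> verts G - {v} \<and> a \<noteq> b}"
    (is "?L \<longleftrightarrow> ?R")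
proof -
  interpret graph G by fact
  have iso': "\<not> u \<rightarrow>\<^bsub>G\<^esub> v" for u
    using iso arcs_ends_symmetric[OF sym_arcs] by blast
  have part: "partition_on (verts G) ((\<lambda>x. {x}) ` verts G)"
    by (auto simp: partition_on_def disjoint_def)
  have sub: "arcs_ends G \<subseteq> {(a, b). a \<in> verts G - {v} \<and> b \<in> verts G - {v} \<and> a \<noteq> b}"
    using iso iso' adj_in_verts adj_not_same by fastforce
  have dom: "v = w" if "dominating_set G {w}" for w
    using isolated_in_dominating_set[OF that v iso] by simp
  show ?thesis
  proof
    assume L: ?L
    have "a \<rightarrow>\<^bsub>G\<^esub> b" if ab: "a \<in> verts G - {v}" "b \<in> verts G - {v}" "a \<noteq> b" for a b
    proof -
      have "\<not> dominating_set G {b}"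
        using dom ab by blast
      then obtain u where "coalition G {b} {u}"
        using L ab unfolding coalition_partition_def by blast
      then have D: "dominating_set G {b, u}"
        by (simp add: coalition_def insert_commute)
      \<comment> \<open>The dominating set \<open>{b, u}\<close> contains \<open>v\<close>, and
        \<open>b\<close> is not \<open>v\<close>. As \<open>a\<close> lies outside
        \<open>{b, v}\<close> and is not adjacent to \<open>v\<close>, it is adjacent to
        \<open>b\<close>.\<close>
      then have "u = v"
        using isolated_in_dominating_set[OF D v iso] ab by auto
      then show ?thesis
        using D ab iso' unfolding dominating_set_def by auto
    qed
    with sub show ?R
      by auto
  next
    assume R: ?R
    \<comment> \<open>All vertices outside \<open>{v, w}\<close> are adjacent to \<open>w\<close>,
      so any \<open>w\<close> other than \<open>v\<close> is a partner for \<open>v\<close>.\<close>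
    have D: "dominating_set G {v, w}" if "w \<in> verts G" "w \<noteq> v" for w
      using that v by (auto simp: dominating_set_def R)
    have coal: "coalition G {v} {w}" "coalition G {w} {v}" if "w \<in> verts G" "w \<noteq> v" for w
      using D[OF that] dom[of w] that v iso'
      by (auto simp: coalition_def insert_commute dominating_set_def[of _ "{v}"])
    have "(dominating_set G {a} \<and> card {a} = 1) \<or>
        (\<not> dominating_set G {a} \<and> (\<exists>B \<in> (\<lambda>x. {x}) ` verts G. coalition G {a} B))"
      if a: "a \<in> verts G" for a
    proof (cases "a = v")
      case False
      then show ?thesis
        using coal(2)[OF a] v unfolding coalition_def by blast
    next
      case True
      show ?thesis
      proof (cases "verts G = {v}")
        case True
        then show ?thesis
          using \<open>a = v\<close> dominating_set_verts[of G] by simp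
      next
        case False
        then obtain w where w: "w \<in> verts G" "w \<noteq> v"
          using v by blast
        then show ?thesis
          using coal(1)[OF w] \<open>a = v\<close> unfolding coalition_def by blast
      qed
    qed
    then show ?L
      using part by (simp add: coalition_partition_def)
  qed
qed

section \<open>Isomorphism with the union of an isolated vertex and a complete graph\<close>

text \<open>Without parallel arcs an arc is determined by its ends, so the arc component of an
  isomorphism can be reconstructed from the vertex bijection, even between different arc
  types.\<close>

lemma digraph_iso_iff_bij_betw:
  assumes G: "nomulti_digraph G" and H: "nomulti_digraph H"
  shows "digraph_iso G H \<longleftrightarrow>
    (\<exists>f. bij_betw f (verts G) (verts H) \<and> arcs_ends H = map_prod f f ` arcs_ends G)"
    (is "?L \<longleftrightarrow> ?R")
proof
  interpret G: nomulti_digraph G by fact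
  assume ?L
  then obtain h where h: "pre_digraph.digraph_isomorphism G h" "H = app_iso h G"
    by (auto simp: digraph_iso_def)
  have "bij_betw (iso_verts h) (verts G) (verts H)"
    using G.digraph_isomorphism_inj_on_verts[OF h(1)] h(2) by (simp add: bij_betw_def)
  moreover have "arcs_ends H = map_prod (iso_verts h) (iso_verts h) ` arcs_ends G"
    using G.arcs_ends_app_iso_eq[OF h(1)] h(2) by (simp add: map_prod_def)
  ultimately show ?R by blast
next
  interpret G: nomulti_digraph G by fact
  interpret H: nomulti_digraph H by fact
  assume ?R
  then obtain f where f: "bij_betw f (verts G) (verts H)"
    and ends: "arcs_ends H = map_prod f f ` arcs_ends G"
    by blast
  have f_inj: "inj_on f (verts G)"
    using f by (simp add: bij_betw_def)
  \<comment> \<open>\<open>e\<close> returns the unique arc of \<open>H\<close> with given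
    ends.\<close>
  define e where "e = the_inv_into (arcs H) (arc_to_ends H)"
  have e: "bij_betw e (arcs_ends H) (arcs H)"
    unfolding e_def arcs_ends_def
    using H.inj_on_arc_to_ends by (intro bij_betw_the_inv_into) (simp add: bij_betw_def)
  have ends_e: "arc_to_ends H (e p) = p" if "p \<in> arcs_ends H" for p
    using that f_the_inv_into_f[OF H.inj_on_arc_to_ends] unfolding e_def arcs_ends_def by blast
  have "bij_betw (arc_to_ends G) (arcs G) (arcs_ends G)"
    using G.inj_on_arc_to_ends by (simp add: bij_betw_def arcs_ends_def)
  moreover have "inj_on (map_prod f f) (arcs_ends G)"
    by (rule inj_on_subset[OF map_prod_inj_on[OF f_inj f_inj]]) (auto dest: G.adj_in_verts)
  then have "bij_betw (map_prod f f) (arcs_ends G) (arcs_ends H)"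
    by (simp add: bij_betw_def ends)
  ultimately have "bij_betw (e \<circ> (map_prod f f \<circ> arc_to_ends G)) (arcs G) (arcs H)"
    using e by (blast intro: bij_betw_trans)
  then have arcs: "bij_betw (\<lambda>a. e (map_prod f f (arc_to_ends G a))) (arcs G) (arcs H)"
    by (simp add: comp_def)
  \<comment> \<open>An arc goes to the arc of \<open>H\<close> joining the images of its ends. The
    head and tail functions are those of \<open>H\<close> itself, since \<open>app_iso h G\<close>
    must equal \<open>H\<close> as a record.\<close>
  define h where "h = \<lparr>iso_verts = f, iso_arcs = \<lambda>a. e (map_prod f f (arc_to_ends G a)),
    iso_head = head H, iso_tail = tail H\<rparr>"
  have "arc_to_ends H (e (map_prod f f (arc_to_ends G a))) = map_prod f f (arc_to_ends G a)"
    if "a \<in> arcs G" for a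
    by (rule ends_e) (use that in \<open>simp add: ends, simp add: arcs_ends_def\<close>)
  then have "G.digraph_isomorphism h"
    using f_inj arcs G.wf_digraph
    by (auto simp: G.digraph_isomorphism_def h_def bij_betw_def arc_to_ends_def)
  moreover have "H = app_iso h G"
    using f arcs by (intro pre_digraph.equality) (auto simp: h_def bij_betw_def)
  ultimately show ?L
    unfolding digraph_iso_def by blast
qed

text \<open>The summand \<open>complete_graph 1\<close> contributes \<open>Inl 0\<close> and no
  arcs, so every arc of \<open>H\<close> has the form \<open>Inr p\<close>. The case
  \<open>m = 0\<close> serves the graph with one vertex.\<close>

lemma
  fixes m :: nat
  defines "H \<equiv> disjoint_union (complete_graph 1) (complete_graph m)"
  shows verts_K1_union_Km: "verts H = insert (Inl 0) (Inr ` {..<m})"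
    and arcs_ends_K1_union_Km: "arcs_ends H = {(a, b).
      a \<in> verts H - {Inl 0} \<and> b \<in> verts H - {Inl 0} \<and> a \<noteq> b}"
    and nomulti_K1_union_Km: "nomulti_digraph H"
proof -
  show V: "verts H = insert (Inl 0) (Inr ` {..<m})"
    by (auto simp: H_def disjoint_union_def complete_graph_def)
  have A: "arcs H = Inr ` {(u, v). u < m \<and> v < m \<and> u \<noteq> v}"
    by (auto simp: H_def disjoint_union_def complete_graph_def)
  have T: "tail H (Inr p) = Inr (fst p)" "head H (Inr p) = Inr (snd p)" for p
    by (simp_all add: H_def disjoint_union_def complete_graph_def)
  show "arcs_ends H = {(a, b). a \<in> verts H - {Inl 0} \<and> b \<in> verts H - {Inl 0} \<and> a \<noteq> b}"
    unfolding arcs_ends_conv A V image_image T by (force simp: image_iff)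
  show "nomulti_digraph H"
    by unfold_locales (auto simp: A V T arc_to_ends_def)
qed

lemma digraph_iso_K1_union_Km_iff:
  assumes G: "graph G" and v: "v \<in> verts G" and iso: "\<And>u. \<not> v \<rightarrow>\<^bsub>G\<^esub> u"
  shows "digraph_iso G (disjoint_union (complete_graph 1) (complete_graph (card (verts G) - 1)))
    \<longleftrightarrow> arcs_ends G = {(a, b). a \<in> verts G - {v} \<and> b \<in> verts G - {v} \<and> a \<noteq> b}"
    (is "digraph_iso G ?H \<longleftrightarrow> ?R")
proof -
  interpret graph G by fact
  note iso_iff = digraph_iso_iff_bij_betw[OF nomulti_digraph nomulti_K1_union_Km]
  note V = verts_K1_union_Km[of "card (verts G) - 1"]
  note E = arcs_ends_K1_union_Km[of "card (verts G) - 1"]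
  show ?thesis
  proof
    assume "digraph_iso G ?H"
    then obtain f where f: "bij_betw f (verts G) (verts ?H)"
      and ends: "arcs_ends ?H = map_prod f f ` arcs_ends G"
      unfolding iso_iff by blast
    have inj: "inj_on f (verts G)"
      using f by (simp add: bij_betw_def)
    have adj_iff: "a \<rightarrow>\<^bsub>G\<^esub> b \<longleftrightarrow> f a \<noteq> Inl 0 \<and> f b \<noteq> Inl 0 \<and> a \<noteq> b"
      if ab: "a \<in> verts G" "b \<in> verts G" for a b
    proof -
      \<comment> \<open>An arc between images comes from some adjacent \<open>x\<close> and
        \<open>y\<close>; injectivity of \<open>f\<close> identifies them with \<open>a\<close> and
        \<open>b\<close>.\<close>
      have "a \<rightarrow>\<^bsub>G\<^esub> b \<longleftrightarrow> f a \<rightarrow>\<^bsub>?H\<^esub> f b"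
      proof
        assume "f a \<rightarrow>\<^bsub>?H\<^esub> f b"
        then obtain x y where xy: "x \<rightarrow>\<^bsub>G\<^esub> y" "f a = f x" "f b = f y"
          unfolding ends by auto
        then show "a \<rightarrow>\<^bsub>G\<^esub> b"
          using ab adj_in_verts[OF xy(1)] inj by (metis inj_onD)
      next
        assume "a \<rightarrow>\<^bsub>G\<^esub> b"
        then show "f a \<rightarrow>\<^bsub>?H\<^esub> f b"
          unfolding ends by force
      qed
      moreover have "f a \<in> verts ?H" "f b \<in> verts ?H" "f a = f b \<longleftrightarrow> a = b"
        using ab f inj by (auto simp: bij_betw_def inj_on_eq_iff)
      ultimately show ?thesis
        unfolding E by auto
    qed
    obtain z where z: "z \<in> verts G" "f z = Inl 0"
      using f V unfolding bij_betw_def by (metis imageE insertI1)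
    have z_iff: "f a = Inl 0 \<longleftrightarrow> a = z" if "a \<in> verts G" for a
      using that z inj by (metis inj_onD)
    text \<open>The isolated vertex need not be unique: \<open>v \<noteq> z\<close> happens when \<open>G\<close> has two
      vertices, and then \<open>G\<close> has no edges.\<close>
    have "v = z \<or> verts G \<subseteq> {v, z}"
      using iso adj_iff[OF v] z_iff v by blast
    \<comment> \<open>If all vertices lie in \<open>{v, z}\<close> with \<open>v\<close> different
      from \<open>z\<close>, distinct \<open>a\<close> and \<open>b\<close> are \<open>v\<close> and
      \<open>z\<close> in some order, and both sides are false.\<close>
    then have "a \<rightarrow>\<^bsub>G\<^esub> b \<longleftrightarrow> a \<noteq> v \<and> b \<noteq> v \<and> a \<noteq> b"
      if "a \<in> verts G" "b \<in> verts G" for a b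
      using adj_iff[OF that] z_iff[OF that(1)] z_iff[OF that(2)] that by blast
    then show ?R
      using adj_in_verts by blast
  next
    assume R: ?R
    have "card (verts G - {v}) = card {..<card (verts G) - 1}"
      using v by simp
    then obtain g where g: "bij_betw g (verts G - {v}) {..<card (verts G) - 1}"
      using finite_same_card_bij by (metis finite_Diff finite_lessThan finite_verts)
    \<comment> \<open>Any numbering \<open>g\<close> of the other vertices will do, since they are
      pairwise adjacent in both graphs.\<close>
    define f :: "'a \<Rightarrow> nat + nat" where "f x = (if x = v then Inl 0 else Inr (g x))" for x
    have img: "f ` (verts G - {v}) = Inr ` {..<card (verts G) - 1}"
      using g by (auto simp: f_def bij_betw_def)
    have ginj: "inj_on g (verts G - {v})"
      using g by (simp add: bij_betw_def)
    have inj: "inj_on f (verts G)"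
      by (auto simp: f_def inj_on_def split: if_splits dest: inj_onD[OF ginj])
    have fv: "f v = Inl 0"
      by (simp add: f_def)
    have image: "f ` verts G = verts ?H"
      unfolding V using img fv v by (metis image_insert insert_Diff)
    have HV: "verts ?H - {Inl 0} = f ` (verts G - {v})"
      unfolding V img by auto
    have "arcs_ends ?H = map_prod f f ` arcs_ends G"
      unfolding E HV R using inj by (auto simp: image_iff inj_on_eq_iff)
    moreover have "bij_betw f (verts G) (verts ?H)"
      using inj image by (simp add: bij_betw_def)
    ultimately show "digraph_iso G ?H"
      unfolding iso_iff by blast
  qed
qed

theorem theorem4:
  fixes G :: "('a, 'b) pre_digraph" and n :: nat
  assumes "graph G"
    and "verts G \<noteq> {}"
    and "card (verts G) = n"
    and "min_degree G = 0"
  shows "coalition_number G = n \<longleftrightarrow>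
    digraph_iso G (disjoint_union (complete_graph 1) (complete_graph (n - 1)))"
proof -
  interpret graph G by fact
  obtain v where v: "v \<in> verts G" and iso: "\<And>u. \<not> v \<rightarrow>\<^bsub>G\<^esub> u"
    using ex_isolated_vertex[OF fin_digraph assms(2,4)] by blast
  have iso': "\<not> u \<rightarrow>\<^bsub>G\<^esub> v" for u
    using iso arcs_ends_symmetric[OF sym_arcs] by blast
  obtain Q where "coalition_partition G Q"
    using ex_coalition_partition_isolated[OF v iso iso'] by blast
  note number_iff = coalition_number_eq_card_iff[OF finite_verts this]
  show ?thesis
    \<comment> \<open>Both sides reduce to the same statement: the edges of \<open>G\<close> are
      exactly the pairs of distinct vertices other than \<open>v\<close>.\<close>
    unfolding assms(3)[symmetric] number_iff
      singleton_coalition_partition_iff[OF assms(1) v iso]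
      digraph_iso_K1_union_Km_iff[OF assms(1) v iso]
    by (rule refl)
qed

end
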